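(* (1) For every compact metric space $X$ and every homeomorphism $f:X\to X$, the set $Sh(f)$ of shadowable points of $f$ is invariant, i.e. $f(Sh(f))=Sh(f)$. Moreover, there exist a compact metric space $X$ and a homeomorphism $f:X\to X$ such that $Sh(f)$ is nonempty and noncompact. (2) For every compact metric space $X$ and every homeomorphism $f:X\to X$, $f$ has the pseudo-orbit tracing property (POTP) if and only if $Sh(f)=X$. (3) For every compact metric space $X$ and every homeomorphism $f:X\to X$, if $CR(f)\subset Sh(f)$, then $CR(f)=\Omega(f)$.
   Context: Let $f:X\to X$ be a homeomorphism of a metric space $(X,d)$. For $\delta>0$, a bi-infinite sequence $\xi=(\xi_n)_{n\in\mathbb{Z}}$ of points of $X$ is a $\delta$-pseudo-orbit (of $f$) if $d(f(\xi_n),\xi_{n+1})\leq\delta$ for all $n\in\mathbb{Z}$. For $\epsilon>0$, the sequence $\xi$ can be $\epsilon$-shadowed if there is $x\in X$ such that $d(f^n(x),\xi_n)\leq\epsilon$ for all $n\in\mathbb{Z}$. $f$ has the POTP if for every $\epsilon>0$ there is $\delta>0$ such that every $\delta$-pseudo-orbit can be $\epsilon$-shadowed. A point $x\in X$ is shadowable if for every $\epsilon>0$ there is $\delta>0$ such that every $\delta$-pseudo-orbit $\xi$ with $\xi_0=x$ can be $\epsilon$-shadowed. $Sh(f)$ denotes the set of shadowable points of $f$. A point $x\in X$ is nonwandering if for every neighborhood $U$ of $x$ there is an integer $k\geq 1$ such that $f^k(U)\cap U\neq\emptyset$. A point $x$ is chain recurrent if for every $\rho>0$ there is a $\rho$-chain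 from $x$ to itself, i.e. a finite sequence $\{x_i:0\leq i\leq n\}$ with $n\geq1$, $x_0=x$, $x_n=x$ and $d(f(x_i),x_{i+1})\leq\rho$ for all $0\leq i\leq n-1$. $\Omega(f)$ and $CR(f)$ denote the sets of nonwandering and chain recurrent points of $f$ respectively. *)

theory Defs
  imports "HOL-Analysis.Analysis"
begin

text \<open>
  Metric spaces are given by a carrier and a distance, \<^term>\<open>Metric_space X d\<close>, so that spaces
  can be quantified over inside a formula. A map on \<open>X\<close> is a total function of which only the
  values on \<open>X\<close> matter.
\<close>

definition compact_metric_homeo :: "'a set \<Rightarrow> ('a \<Rightarrow> 'a \<Rightarrow> real) \<Rightarrow> ('a \<Rightarrow> 'a) \<Rightarrow> bool" where
  "compact_metric_homeo X d f \<longleftrightarrow>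
     Metric_space X d \<and>
     compact_space (Metric_space.mtopology X d) \<and>
     homeomorphic_map (Metric_space.mtopology X d) (Metric_space.mtopology X d) f"

definition int_iterate :: "'a set \<Rightarrow> ('a \<Rightarrow> 'a) \<Rightarrow> int \<Rightarrow> 'a \<Rightarrow> 'a" where
  "int_iterate X f n =
     (if n \<ge> 0 then f ^^ nat n else inv_into X f ^^ nat (- n))"

definition pseudo_orbit ::
  "'a set \<Rightarrow> ('a \<Rightarrow> 'a \<Rightarrow> real) \<Rightarrow> ('a \<Rightarrow> 'a) \<Rightarrow> real \<Rightarrow> (int \<Rightarrow> 'a) \<Rightarrow> bool" where
  "pseudo_orbit X d f \<delta> \<xi> \<longleftrightarrow>
     (\<forall>n. \<xi> n \<in> X) \<and> (\<forall>n. d (f (\<xi> n)) (\<xi> (n + 1)) \<le> \<delta>)"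

definition can_be_shadowed ::
  "'a set \<Rightarrow> ('a \<Rightarrow> 'a \<Rightarrow> real) \<Rightarrow> ('a \<Rightarrow> 'a) \<Rightarrow> real \<Rightarrow> (int \<Rightarrow> 'a) \<Rightarrow> bool" where
  "can_be_shadowed X d f \<epsilon> \<xi> \<longleftrightarrow>
     (\<exists>x\<in>X. \<forall>n. d (int_iterate X f n x) (\<xi> n) \<le> \<epsilon>)"

definition POTP :: "'a set \<Rightarrow> ('a \<Rightarrow> 'a \<Rightarrow> real) \<Rightarrow> ('a \<Rightarrow> 'a) \<Rightarrow> bool" where
  "POTP X d f \<longleftrightarrow>
     (\<forall>\<epsilon>>0. \<exists>\<delta>>0. \<forall>\<xi>. pseudo_orbit X d f \<delta> \<xi> \<longrightarrow> can_be_shadowed X d f \<epsilon> \<xi>)"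

definition Sh :: "'a set \<Rightarrow> ('a \<Rightarrow> 'a \<Rightarrow> real) \<Rightarrow> ('a \<Rightarrow> 'a) \<Rightarrow> 'a set" where
  "Sh X d f =
     {x \<in> X. \<forall>\<epsilon>>0. \<exists>\<delta>>0. \<forall>\<xi>. pseudo_orbit X d f \<delta> \<xi> \<and> \<xi> 0 = x \<longrightarrow>
        can_be_shadowed X d f \<epsilon> \<xi>}"

definition nonwandering_set :: "'a set \<Rightarrow> ('a \<Rightarrow> 'a \<Rightarrow> real) \<Rightarrow> ('a \<Rightarrow> 'a) \<Rightarrow> 'a set" where
  "nonwandering_set X d f =
     {x \<in> X. \<forall>U. openin (Metric_space.mtopology X d) U \<and> x \<in> U \<longrightarrow>
        (\<exists>k\<ge>1. (f ^^ k) ` U \<inter> U \<noteq> {})}"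

definition is_chain ::
  "'a set \<Rightarrow> ('a \<Rightarrow> 'a \<Rightarrow> real) \<Rightarrow> ('a \<Rightarrow> 'a) \<Rightarrow> real \<Rightarrow> nat \<Rightarrow> (nat \<Rightarrow> 'a) \<Rightarrow> bool" where
  "is_chain X d f \<rho> n c \<longleftrightarrow>
     n \<ge> 1 \<and> (\<forall>i\<le>n. c i \<in> X) \<and> (\<forall>i<n. d (f (c i)) (c (Suc i)) \<le> \<rho>)"

definition chain_recurrent_set :: "'a set \<Rightarrow> ('a \<Rightarrow> 'a \<Rightarrow> real) \<Rightarrow> ('a \<Rightarrow> 'a) \<Rightarrow> 'a set" where
  "chain_recurrent_set X d f =
     {x \<in> X. \<forall>\<rho>>0. \<exists>n c. is_chain X d f \<rho> n c \<and> c 0 = x \<and> c n = x}"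

end

theory Submission
  imports Defs
begin

text \<open>
  Shadowability at \<open>x\<close> speaks of pseudo-orbits that are exactly at \<open>x\<close> at time 0. On a compact space
  uniform continuity makes it robust (\<open>shadowable_nearby\<close>): all sufficiently fine pseudo-orbits that
  come sufficiently near \<open>x\<close> at some time can be shadowed. Invariance of \<open>Sh\<close> follows because a fine
  pseudo-orbit through \<open>x\<close> passes near \<open>f x\<close> one step later, and one through \<open>f x\<close> passes near \<open>x\<close>
  one step earlier. The passage from pointwise shadowability to the POTP is a compactness argument:
  finitely many balls on which the robust form holds cover the space.

  A chain from \<open>x\<close> to itself, repeated periodically, is a pseudo-orbit through \<open>x\<close>. If \<open>x\<close> is
  shadowable, a true orbit follows it and so returns near \<open>x\<close>; hence shadowable chain recurrent
  points are nonwandering. Nonwandering points are chain recurrent on every compact space.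

  For the identity map, pseudo-orbits cannot leave an isolated point but can creep along an
  interval, while true orbits do not move. So in \<open>[-1, 0] \<union> {1, 1/2, 1/4, \<dots>}\<close> the powers of \<open>1/2\<close> are
  shadowable and their limit 0 is not, which makes \<open>Sh\<close> nonempty and not closed.
\<close>

section \<open>Compact metric dynamical systems\<close>

locale compact_homeo = Metric_space X d for X :: "'a set" and d +
  fixes f :: "'a \<Rightarrow> 'a"
  assumes compact: "compact_space mtopology"
    and homeo: "homeomorphic_map mtopology mtopology f"

lemma compact_metric_homeo_iff_locale:
  "compact_metric_homeo X d f \<longleftrightarrow> compact_homeo X d f"
  by (simp add: compact_metric_homeo_def compact_homeo_def compact_homeo_axioms_def)

context compact_homeo
begin

abbreviation T :: "int \<Rightarrow> 'a \<Rightarrow> 'a" where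
  "T \<equiv> int_iterate X f"

lemma f_image: "f ` X = X"
  using homeomorphic_imp_surjective_map[OF homeo] by simp

lemma f_inj: "inj_on f X"
  using homeomorphic_imp_injective_map[OF homeo] by simp

lemma f_in [simp]: "x \<in> X \<Longrightarrow> f x \<in> X"
  using f_image by blast

lemma inv_in: "x \<in> X \<Longrightarrow> inv_into X f x \<in> X"
  by (simp add: f_image inv_into_into)

lemma f_inv: "x \<in> X \<Longrightarrow> f (inv_into X f x) = x"
  by (simp add: f_image f_inv_into_f)

lemma T_in [simp]:
  assumes "x \<in> X" shows "T n x \<in> X"
proof -
  have "(f ^^ k) x \<in> X" "(inv_into X f ^^ k) x \<in> X" for k
    by (induction k) (use assms inv_in in auto)
  then show ?thesis
    by (simp add: int_iterate_def)
qed

lemma T_of_nat [simp]: "T (int n) x = (f ^^ n) x"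
  by (simp add: int_iterate_def)

lemma T_0 [simp]: "T 0 x = x"
  by (simp add: int_iterate_def)

lemma T_Suc:
  assumes "x \<in> X" shows "T (n + 1) x = f (T n x)"
proof (cases "n \<ge> 0")
  case True
  then show ?thesis
    by (simp add: int_iterate_def nat_add_distrib)
next
  case False
  then obtain k where "n = - int (Suc k)"
    by (metis int_cases2 of_nat_0_le_iff not0_implies_Suc minus_zero of_nat_0)
  then have "T n x = inv_into X f (T (n + 1) x)"
    by (auto simp: int_iterate_def nat_add_distrib)
  then show ?thesis
    using f_inv T_in[OF assms] by metis
qed

lemma T_add:
  assumes "x \<in> X" shows "T (n + m) x = T n (T m x)"
proof (induction n rule: int_induct[where k = 0])
  case base
  show ?case by simp
next
  case (step1 i)
  then show ?case
    using T_Suc[of x "i + m"] T_Suc[of "T m x" i] assms by (simp add: algebra_simps)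
next
  case (step2 i)
  \<comment> \<open>Both candidates for the preceding point have the same image, and \<open>f\<close> is injective.\<close>
  have "f (T (i - 1 + m) x) = f (T (i - 1) (T m x))"
    using step2 T_Suc[of x "i - 1 + m"] T_Suc[of "T m x" "i - 1"] assms
    by (simp add: algebra_simps)
  then show ?case
    using f_inj assms by (simp add: inj_on_eq_iff)
qed

lemma uniform_continuity:
  assumes "\<epsilon> > 0"
  obtains \<delta> where "\<delta> > 0"
    "\<And>x y. \<lbrakk>x \<in> X; y \<in> X; d x y \<le> \<delta>\<rbrakk> \<Longrightarrow> d (f x) (f y) \<le> \<epsilon>"
proof -
  have "uniformly_continuous_map (metric (X, d)) (metric (X, d)) f"
    using compact homeomorphic_imp_continuous_map[OF homeo]
    by (intro continuous_imp_uniformly_continuous_map) auto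
  then obtain \<delta> where "\<delta> > 0"
    and \<delta>: "\<And>x y. \<lbrakk>x \<in> X; y \<in> X; d y x < \<delta>\<rbrakk> \<Longrightarrow> d (f y) (f x) < \<epsilon>"
    using assms unfolding uniformly_continuous_map_def mspace_metric mdist_metric by metis
  show ?thesis
  proof (rule that[of "\<delta> / 2"])
    show "\<delta> / 2 > 0"
      using \<open>\<delta> > 0\<close> by simp
    show "d (f x) (f y) \<le> \<epsilon>" if "x \<in> X" "y \<in> X" "d x y \<le> \<delta> / 2" for x y
      using \<delta>[of y x] that \<open>\<delta> > 0\<close> by fastforce
  qed
qed

text \<open>
  Moving each point of a sequence a little keeps it close to being an orbit: the jump from
  \<open>f a'\<close> to \<open>b'\<close> passes through \<open>f a\<close> and \<open>b\<close>, and the first of the three legs is controlled by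
  uniform continuity.
\<close>

lemma perturbed_jump:
  assumes "\<epsilon> > 0"
  obtains \<delta> where "\<delta> > 0"
    "\<And>a b a' b'. \<lbrakk>a \<in> X; b \<in> X; a' \<in> X; b' \<in> X; d a a' \<le> \<delta>; d (f a) b \<le> \<delta>; d b b' \<le> \<delta>\<rbrakk>
       \<Longrightarrow> d (f a') b' \<le> \<epsilon>"
proof -
  obtain \<eta> where "\<eta> > 0"
    and \<eta>: "\<And>x y. \<lbrakk>x \<in> X; y \<in> X; d x y \<le> \<eta>\<rbrakk> \<Longrightarrow> d (f x) (f y) \<le> \<epsilon> / 3"
    using uniform_continuity[of "\<epsilon> / 3"] assms by auto
  show ?thesis
  proof (rule that[of "min \<eta> (\<epsilon> / 3)"])
    show "min \<eta> (\<epsilon> / 3) > 0"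
      using \<open>\<eta> > 0\<close> assms by simp
    fix a b a' b'
    assume *: "a \<in> X" "b \<in> X" "a' \<in> X" "b' \<in> X" "d a a' \<le> min \<eta> (\<epsilon> / 3)"
      "d (f a) b \<le> min \<eta> (\<epsilon> / 3)" "d b b' \<le> min \<eta> (\<epsilon> / 3)"
    have "d (f a') b' \<le> d (f a) (f a') + d (f a) b + d b b'"
      using triangle[of "f a'" "f a" b'] triangle[of "f a" b b'] commute[of "f a" "f a'"] *
      by simp
    then show "d (f a') b' \<le> \<epsilon>"
      using \<eta>[of a a'] * by simp
  qed
qed

section \<open>Pseudo-orbits that pass near a shadowable point\<close>

text \<open>
  This robust form of shadowability is what the invariance of \<open>Sh\<close> and the compactness argument
  for the POTP rest on. A pseudo-orbit that is near \<open>x\<close> at time \<open>m\<close> becomes, after a time shift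
  by \<open>m\<close> and the replacement of its new initial point by \<open>x\<close>, a pseudo-orbit through \<open>x\<close>; and a
  point that shadows the modified sequence shadows the original one once shifted back.
\<close>

lemma shadowable_nearby:
  assumes "x \<in> Sh X d f" "\<epsilon> > 0"
  obtains \<gamma> where "\<gamma> > 0"
    "\<And>\<xi> m. \<lbrakk>pseudo_orbit X d f \<gamma> \<xi>; d (\<xi> m) x \<le> \<gamma>\<rbrakk> \<Longrightarrow> can_be_shadowed X d f \<epsilon> \<xi>"
proof -
  have "x \<in> X"
    using assms by (simp add: Sh_def)
  obtain \<delta> where "\<delta> > 0"
    and \<delta>: "\<And>\<xi>. \<lbrakk>pseudo_orbit X d f \<delta> \<xi>; \<xi> 0 = x\<rbrakk> \<Longrightarrow> can_be_shadowed X d f (\<epsilon> / 2) \<xi>"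
    using assms unfolding Sh_def by (force dest: spec[of _ "\<epsilon> / 2"])
  obtain \<beta> where "\<beta> > 0"
    and \<beta>: "\<And>a b a' b'. \<lbrakk>a \<in> X; b \<in> X; a' \<in> X; b' \<in> X; d a a' \<le> \<beta>; d (f a) b \<le> \<beta>; d b b' \<le> \<beta>\<rbrakk>
       \<Longrightarrow> d (f a') b' \<le> \<delta>"
    using perturbed_jump[OF \<open>\<delta> > 0\<close>] by blast
  define \<gamma> where "\<gamma> = min \<beta> (\<epsilon> / 2)"
  show ?thesis
  proof (rule that[of \<gamma>])
    show "\<gamma> > 0"
      using \<open>\<beta> > 0\<close> assms by (simp add: \<gamma>_def)
    fix \<xi> m
    assume \<xi>: "pseudo_orbit X d f \<gamma> \<xi>" and near: "d (\<xi> m) x \<le> \<gamma>"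
    define \<eta> where "\<eta> n = (if n = 0 then x else \<xi> (n + m))" for n
    have \<xi>X: "\<xi> n \<in> X" and jump: "d (f (\<xi> n)) (\<xi> (n + 1)) \<le> \<gamma>" for n
      using \<xi> by (auto simp: pseudo_orbit_def)
    have \<eta>X: "\<eta> n \<in> X" for n
      using \<xi>X \<open>x \<in> X\<close> by (simp add: \<eta>_def)
    have close: "d (\<xi> (n + m)) (\<eta> n) \<le> \<gamma>" for n
      using near \<xi>X \<open>\<gamma> > 0\<close> by (simp add: \<eta>_def)
    have "d (f (\<eta> n)) (\<eta> (n + 1)) \<le> \<delta>" for n
      using \<beta>[of "\<xi> (n + m)" "\<xi> (n + 1 + m)" "\<eta> n" "\<eta> (n + 1)"]
        \<xi>X \<eta>X close[of n] close[of "n + 1"] jump[of "n + m"]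
      by (simp add: \<gamma>_def algebra_simps)
    then have "pseudo_orbit X d f \<delta> \<eta>"
      using \<eta>X by (simp add: pseudo_orbit_def)
    then obtain y where "y \<in> X" and y: "\<And>n. d (T n y) (\<eta> n) \<le> \<epsilon> / 2"
      using \<delta>[of \<eta>] by (auto simp: can_be_shadowed_def \<eta>_def)
    have "d (T n (T (- m) y)) (\<xi> n) \<le> \<epsilon>" for n
    proof -
      have "d (T n (T (- m) y)) (\<xi> n) = d (T (n - m) y) (\<xi> n)"
        using T_add[of y n "- m"] \<open>y \<in> X\<close> by simp
      also have "\<dots> \<le> d (T (n - m) y) (\<eta> (n - m)) + d (\<xi> n) (\<eta> (n - m))"
        using triangle[of "T (n - m) y" "\<eta> (n - m)" "\<xi> n"] commute \<xi>X \<eta>X \<open>y \<in> X\<close> by simp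
      also have "\<dots> \<le> \<epsilon>"
        using y[of "n - m"] close[of "n - m"] by (simp add: \<gamma>_def)
      finally show ?thesis .
    qed
    then show "can_be_shadowed X d f \<epsilon> \<xi>"
      unfolding can_be_shadowed_def using T_in[OF \<open>y \<in> X\<close>] by blast
  qed
qed

section \<open>Invariance of the set of shadowable points\<close>

text \<open>
  If \<open>f x = y\<close>, a fine pseudo-orbit through \<open>x\<close> at time 0 passes near \<open>y\<close> at time 1.
\<close>

lemma shadowable_if_image_shadowable:
  assumes "x \<in> X" "f x \<in> Sh X d f"
  shows "x \<in> Sh X d f"
proof -
  have "\<exists>\<delta>>0. \<forall>\<xi>. pseudo_orbit X d f \<delta> \<xi> \<and> \<xi> 0 = x \<longrightarrow> can_be_shadowed X d f \<epsilon> \<xi>"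
    if "\<epsilon> > 0" for \<epsilon>
  proof -
    obtain \<gamma> where "\<gamma> > 0" and \<gamma>:
      "\<And>\<xi> m. \<lbrakk>pseudo_orbit X d f \<gamma> \<xi>; d (\<xi> m) (f x) \<le> \<gamma>\<rbrakk> \<Longrightarrow> can_be_shadowed X d f \<epsilon> \<xi>"
      using shadowable_nearby[OF assms(2) \<open>\<epsilon> > 0\<close>] by blast
    have "can_be_shadowed X d f \<epsilon> \<xi>" if \<xi>: "pseudo_orbit X d f \<gamma> \<xi>" "\<xi> 0 = x" for \<xi>
    proof (rule \<gamma>[OF \<xi>(1), of 1])
      have "d (f (\<xi> 0)) (\<xi> (0 + 1)) \<le> \<gamma>"
        using \<xi>(1) unfolding pseudo_orbit_def by blast
      then show "d (\<xi> 1) (f x) \<le> \<gamma>"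
        using \<xi> by (simp add: commute)
    qed
    then show ?thesis
      using \<open>\<gamma> > 0\<close> by blast
  qed
  then show ?thesis
    using assms(1) by (simp add: Sh_def)
qed

lemma uniform_continuity_inverse:
  assumes "\<epsilon> > 0"
  obtains \<delta> where "\<delta> > 0"
    "\<And>x y. \<lbrakk>x \<in> X; y \<in> X; d (f x) (f y) \<le> \<delta>\<rbrakk> \<Longrightarrow> d x y \<le> \<epsilon>"
proof -
  obtain g where g: "homeomorphic_maps mtopology mtopology f g"
    using homeo homeomorphic_map_maps by blast
  then interpret g: compact_homeo X d g
    using compact homeomorphic_maps_sym homeomorphic_map_maps by unfold_locales blast+
  have gf: "g (f x) = x" if "x \<in> X" for x
    using g that by (simp add: homeomorphic_maps_def)
  show ?thesis
    using g.uniform_continuity[OF assms] that gf f_in by metis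
qed

text \<open>
  A fine pseudo-orbit with \<open>\<xi> 0 = f x\<close> has \<open>f (\<xi> (-1))\<close> near \<open>f x\<close>, so that \<open>\<xi> (-1)\<close> is near \<open>x\<close>
  because the inverse of \<open>f\<close> is uniformly continuous.
\<close>

lemma image_shadowable:
  assumes "x \<in> Sh X d f"
  shows "f x \<in> Sh X d f"
proof -
  have "x \<in> X"
    using assms by (simp add: Sh_def)
  have "\<exists>\<delta>>0. \<forall>\<xi>. pseudo_orbit X d f \<delta> \<xi> \<and> \<xi> 0 = f x \<longrightarrow> can_be_shadowed X d f \<epsilon> \<xi>"
    if "\<epsilon> > 0" for \<epsilon>
  proof -
    obtain \<gamma> where "\<gamma> > 0" and \<gamma>:
      "\<And>\<xi> m. \<lbrakk>pseudo_orbit X d f \<gamma> \<xi>; d (\<xi> m) x \<le> \<gamma>\<rbrakk> \<Longrightarrow> can_be_shadowed X d f \<epsilon> \<xi>"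
      using shadowable_nearby[OF assms \<open>\<epsilon> > 0\<close>] by blast
    obtain \<eta> where "\<eta> > 0" and \<eta>:
      "\<And>y z. \<lbrakk>y \<in> X; z \<in> X; d (f y) (f z) \<le> \<eta>\<rbrakk> \<Longrightarrow> d y z \<le> \<gamma>"
      using uniform_continuity_inverse[OF \<open>\<gamma> > 0\<close>] by blast
    have "can_be_shadowed X d f \<epsilon> \<xi>"
      if \<xi>: "pseudo_orbit X d f (min \<gamma> \<eta>) \<xi>" "\<xi> 0 = f x" for \<xi>
    proof (rule \<gamma>[of \<xi> "-1"])
      show "pseudo_orbit X d f \<gamma> \<xi>"
        using \<xi>(1) by (simp add: pseudo_orbit_def)
      have "d (f (\<xi> (-1))) (\<xi> (-1 + 1)) \<le> \<eta>" "\<xi> (-1) \<in> X"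
        using \<xi>(1) unfolding pseudo_orbit_def by (metis min.boundedE)+
      then show "d (\<xi> (-1)) x \<le> \<gamma>"
        using \<eta> \<open>x \<in> X\<close> \<xi>(2) by simp
    qed
    then show ?thesis
      using \<open>\<gamma> > 0\<close> \<open>\<eta> > 0\<close> by (intro exI[of _ "min \<gamma> \<eta>"]) simp
  qed
  then show ?thesis
    using \<open>x \<in> X\<close> by (simp add: Sh_def)
qed

lemma shadowable_set_invariant: "f ` Sh X d f = Sh X d f"
proof
  show "f ` Sh X d f \<subseteq> Sh X d f"
    using image_shadowable by blast
  show "Sh X d f \<subseteq> f ` Sh X d f"
  proof
    fix y assume y: "y \<in> Sh X d f"
    then have "y \<in> f ` X"
      by (simp add: f_image Sh_def)
    then obtain x where "x \<in> X" "y = f x"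
      by blast
    then show "y \<in> f ` Sh X d f"
      using y shadowable_if_image_shadowable by blast
  qed
qed

section \<open>Pointwise shadowing and the POTP\<close>

text \<open>
  If every point is shadowable, the scales given by the robust form of shadowability define an open
  cover of \<open>X\<close>. Since \<open>\<xi> 0\<close> always lies in one of finitely many of these balls, the smallest of
  the corresponding scales works for all pseudo-orbits.
\<close>

lemma POTP_iff_all_shadowable: "POTP X d f \<longleftrightarrow> Sh X d f = X"
proof
  assume "POTP X d f"
  then show "Sh X d f = X"
    unfolding POTP_def Sh_def by blast
next
  assume all: "Sh X d f = X"
  show "POTP X d f"
    unfolding POTP_def
  proof (intro allI impI)
    fix \<epsilon> :: real
    assume "\<epsilon> > 0"
    have "\<exists>\<gamma>>0. \<forall>\<xi>. pseudo_orbit X d f \<gamma> \<xi> \<and> d (\<xi> 0) x \<le> \<gamma> \<longrightarrow> can_be_shadowed X d f \<epsilon> \<xi>"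
      if "x \<in> X" for x
      using shadowable_nearby[of x, OF _ \<open>\<epsilon> > 0\<close>] that all by metis
    then obtain \<gamma> where \<gamma>pos: "\<And>x. x \<in> X \<Longrightarrow> \<gamma> x > 0" and \<gamma>:
      "\<And>x \<xi>. \<lbrakk>x \<in> X; pseudo_orbit X d f (\<gamma> x) \<xi>; d (\<xi> 0) x \<le> \<gamma> x\<rbrakk> \<Longrightarrow> can_be_shadowed X d f \<epsilon> \<xi>"
      by metis
    have "\<exists>\<F>. finite \<F> \<and> \<F> \<subseteq> (\<lambda>x. mball x (\<gamma> x)) ` X \<and> X \<subseteq> \<Union>\<F>"
    proof (rule compactinD)
      show "compactin mtopology X"
        using compact by (simp add: compact_space_def)
    qed (use \<gamma>pos in auto)
    then obtain \<F> where \<F>: "finite \<F>" "\<F> \<subseteq> (\<lambda>x. mball x (\<gamma> x)) ` X" "X \<subseteq> \<Union>\<F>"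
      by blast
    then obtain F where "finite F" "F \<subseteq> X" and cover: "X \<subseteq> (\<Union>x\<in>F. mball x (\<gamma> x))"
      using finite_subset_image[OF \<F>(1,2)] by blast
    \<comment> \<open>The element 1 keeps the minimum well defined when \<open>X\<close>, and hence \<open>F\<close>, is empty.\<close>
    define \<delta> where "\<delta> = Min (insert 1 (\<gamma> ` F))"
    have "\<delta> > 0"
      using \<gamma>pos \<open>finite F\<close> \<open>F \<subseteq> X\<close> by (auto simp: \<delta>_def)
    have "can_be_shadowed X d f \<epsilon> \<xi>" if \<xi>: "pseudo_orbit X d f \<delta> \<xi>" for \<xi>
    proof -
      have "\<xi> 0 \<in> X"
        using \<xi> by (simp add: pseudo_orbit_def)
      then obtain x where "x \<in> F" "\<xi> 0 \<in> mball x (\<gamma> x)"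
        using cover by blast
      moreover have "\<delta> \<le> \<gamma> x"
        using \<open>x \<in> F\<close> \<open>finite F\<close> by (simp add: \<delta>_def)
      then have "pseudo_orbit X d f (\<gamma> x) \<xi>"
        using \<xi> unfolding pseudo_orbit_def by (meson order_trans)
      ultimately show ?thesis
        using \<gamma>[of x \<xi>] \<open>F \<subseteq> X\<close> by (auto simp: commute)
    qed
    then show "\<exists>\<delta>>0. \<forall>\<xi>. pseudo_orbit X d f \<delta> \<xi> \<longrightarrow> can_be_shadowed X d f \<epsilon> \<xi>"
      using \<open>\<delta> > 0\<close> by blast
  qed
qed

section \<open>Chain recurrent and nonwandering points\<close>

text \<open>
  An orbit segment \<open>y, f y, \<dots>, f\<^sup>k y\<close> that starts and ends near \<open>x\<close> becomes a chain from \<open>x\<close> to \<open>x\<close>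
  when its two end points are replaced by \<open>x\<close>.
\<close>

lemma nonwandering_imp_chain_recurrent:
  "nonwandering_set X d f \<subseteq> chain_recurrent_set X d f"
proof
  fix x assume x: "x \<in> nonwandering_set X d f"
  then have "x \<in> X"
    by (simp add: nonwandering_set_def)
  have "\<exists>n c. is_chain X d f \<rho> n c \<and> c 0 = x \<and> c n = x" if "\<rho> > 0" for \<rho>
  proof -
    obtain \<beta> where "\<beta> > 0"
      and \<beta>: "\<And>a b a' b'. \<lbrakk>a \<in> X; b \<in> X; a' \<in> X; b' \<in> X; d a a' \<le> \<beta>; d (f a) b \<le> \<beta>; d b b' \<le> \<beta>\<rbrakk>
         \<Longrightarrow> d (f a') b' \<le> \<rho>"
      using perturbed_jump[OF \<open>\<rho> > 0\<close>] by blast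
    have "openin mtopology (mball x \<beta>) \<and> x \<in> mball x \<beta>"
      using \<open>x \<in> X\<close> \<open>\<beta> > 0\<close> by simp
    then have "\<exists>k\<ge>1. (f ^^ k) ` mball x \<beta> \<inter> mball x \<beta> \<noteq> {}"
      using x unfolding nonwandering_set_def by blast
    then obtain k y where "k \<ge> 1" "y \<in> mball x \<beta>" "(f ^^ k) y \<in> mball x \<beta>"
      by blast
    then have y: "y \<in> X" "d y x \<le> \<beta>" "d ((f ^^ k) y) x \<le> \<beta>"
      by (auto simp: commute)
    define c where "c i = (if i = 0 \<or> i = k then x else (f ^^ i) y)" for i
    have orbX: "(f ^^ i) y \<in> X" for i
      using T_in[OF \<open>y \<in> X\<close>, of "int i"] by simp
    have cX: "c i \<in> X" for i
      using \<open>x \<in> X\<close> orbX by (simp add: c_def)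
    have close: "d ((f ^^ i) y) (c i) \<le> \<beta>" for i
      using y orbX \<open>\<beta> > 0\<close> by (simp add: c_def)
    have "d (f (c i)) (c (Suc i)) \<le> \<rho>" for i
      using \<beta>[of "(f ^^ i) y" "(f ^^ Suc i) y" "c i" "c (Suc i)"]
        orbX[of i] orbX[of "Suc i"] cX close[of i] close[of "Suc i"] \<open>\<beta> > 0\<close> by simp
    then have "is_chain X d f \<rho> k c"
      using cX \<open>k \<ge> 1\<close> by (simp add: is_chain_def)
    moreover have "c 0 = x" "c k = x"
      by (simp_all add: c_def)
    ultimately show ?thesis
      by blast
  qed
  then show "x \<in> chain_recurrent_set X d f"
    using \<open>x \<in> X\<close> by (simp add: chain_recurrent_set_def)
qed

lemma periodic_extension_pseudo_orbit:
  assumes "is_chain X d f \<delta> n c" "c n = c 0"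
  shows "pseudo_orbit X d f \<delta> (\<lambda>i. c (nat (i mod int n)))"
  unfolding pseudo_orbit_def
proof (intro conjI allI)
  fix i :: int
  have "n \<ge> 1" and cX: "\<And>j. j \<le> n \<Longrightarrow> c j \<in> X"
    and jump: "\<And>j. j < n \<Longrightarrow> d (f (c j)) (c (Suc j)) \<le> \<delta>"
    using assms(1) by (auto simp: is_chain_def)
  define j where "j = nat (i mod int n)"
  have j: "i mod int n = int j" "j < n"
    using \<open>n \<ge> 1\<close> by (auto simp: j_def nat_less_iff)
  then show "c (nat (i mod int n)) \<in> X"
    using cX by simp
  have "(i + 1) mod int n = (int j + 1) mod int n"
    using j(1) by (metis mod_add_left_eq)
  then have "c (nat ((i + 1) mod int n)) = c (Suc j)"
    using j(2) assms(2) by (cases "Suc j = n") (auto simp: nat_add_distrib add.commute[of "int j"])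
  then show "d (f (c (nat (i mod int n)))) (c (nat ((i + 1) mod int n))) \<le> \<delta>"
    using jump j by simp
qed

text \<open>
  A chain from \<open>x\<close> to \<open>x\<close>, repeated periodically, is a pseudo-orbit through \<open>x\<close>. The point that
  shadows it is near \<open>x\<close> at time 0 and again after one period, so \<open>x\<close> is nonwandering.
\<close>

lemma shadowable_chain_recurrent_imp_nonwandering:
  assumes "x \<in> chain_recurrent_set X d f" "x \<in> Sh X d f"
  shows "x \<in> nonwandering_set X d f"
proof -
  have "x \<in> X"
    using assms by (simp add: Sh_def)
  have "\<exists>k\<ge>1. (f ^^ k) ` U \<inter> U \<noteq> {}" if U: "openin mtopology U" "x \<in> U" for U
  proof -
    obtain \<epsilon> where "\<epsilon> > 0" "mcball x \<epsilon> \<subseteq> U"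
      using U by (meson openin_mtopology_mcball)
    obtain \<delta> where "\<delta> > 0"
      and \<delta>: "\<And>\<xi>. \<lbrakk>pseudo_orbit X d f \<delta> \<xi>; \<xi> 0 = x\<rbrakk> \<Longrightarrow> can_be_shadowed X d f \<epsilon> \<xi>"
      using assms(2) \<open>\<epsilon> > 0\<close> unfolding Sh_def by blast
    obtain n c where c: "is_chain X d f \<delta> n c" "c 0 = x" "c n = x"
      using assms(1) \<open>\<delta> > 0\<close> unfolding chain_recurrent_set_def by blast
    obtain y where "y \<in> X" and y: "\<And>i. d (T i y) (c (nat (i mod int n))) \<le> \<epsilon>"
      using \<delta>[OF periodic_extension_pseudo_orbit[OF c(1)]] c(2,3)
      by (auto simp: can_be_shadowed_def)
    have "y \<in> mcball x \<epsilon>" "(f ^^ n) y \<in> mcball x \<epsilon>"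
      using y[of 0] y[of "int n"] c(2) \<open>x \<in> X\<close> \<open>y \<in> X\<close> T_in[OF \<open>y \<in> X\<close>, of "int n"]
      by (auto simp: commute)
    then have "(f ^^ n) ` U \<inter> U \<noteq> {}"
      using \<open>mcball x \<epsilon> \<subseteq> U\<close> by blast
    then show ?thesis
      using c(1) unfolding is_chain_def by blast
  qed
  then show ?thesis
    using \<open>x \<in> X\<close> by (simp add: nonwandering_set_def)
qed

lemma chain_recurrent_eq_nonwandering:
  assumes "chain_recurrent_set X d f \<subseteq> Sh X d f"
  shows "chain_recurrent_set X d f = nonwandering_set X d f"
  using assms nonwandering_imp_chain_recurrent shadowable_chain_recurrent_imp_nonwandering by blast

end

section \<open>A shadowable set that is not compact\<close>

definition interval_and_sequence :: "real set" where
  "interval_and_sequence = {-1..0} \<union> range (\<lambda>n. (1 / 2 :: real) ^ n)"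

lemma mtopology_subset:
  fixes X :: "'a::metric_space set"
  shows "Metric_space.mtopology X dist = top_of_set X"
proof -
  interpret Submetric UNIV dist X
    by (simp add: Submetric.intro Submetric_axioms_def Met_TC.Metric_space_axioms)
  show ?thesis
    using mtopology_submetric by simp
qed

lemma compact_interval_and_sequence: "compact interval_and_sequence"
proof -
  have "compact (insert 0 (range (\<lambda>n. (1 / 2 :: real) ^ n)))"
    by (rule compact_sequence_with_limit[OF LIMSEQ_power_zero]) simp
  then have "compact ({-1..0} \<union> insert 0 (range (\<lambda>n. (1 / 2 :: real) ^ n)))"
    by (intro compact_Un compact_Icc)
  also have "{-1..0} \<union> insert 0 (range (\<lambda>n. (1 / 2 :: real) ^ n)) = interval_and_sequence"
    by (auto simp: interval_and_sequence_def)
  finally show ?thesis .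
qed

lemma identity_compact_metric_homeo:
  fixes X :: "'a::metric_space set"
  assumes "compact X"
  shows "compact_metric_homeo X dist id"
  using assms Metric_space.subspace[OF Met_TC.Metric_space_axioms, of X]
  by (simp add: compact_metric_homeo_def mtopology_subset compact_space_subtopology)

lemma int_iterate_id:
  assumes "x \<in> X" shows "int_iterate X id n x = x"
proof -
  have "(inv_into X id ^^ k) x = x" for k
    using assms by (induction k) (auto simp: inv_into_f_f)
  then show ?thesis
    by (simp add: int_iterate_def)
qed

text \<open>For the identity, a pseudo-orbit whose jumps are too short to reach another point never leaves \<open>x\<close>.\<close>

lemma isolated_shadowable_identity:
  fixes X :: "'a::metric_space set"
  assumes "x \<in> X" "r > 0" and isolated: "\<And>y. \<lbrakk>y \<in> X; dist x y \<le> r\<rbrakk> \<Longrightarrow> y = x"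
  shows "x \<in> Sh X dist id"
proof -
  have "can_be_shadowed X dist id \<epsilon> \<xi>"
    if \<xi>: "pseudo_orbit X dist id r \<xi>" "\<xi> 0 = x" and "\<epsilon> > 0" for \<epsilon> \<xi>
  proof -
    have \<xi>X: "\<xi> n \<in> X" and jump: "dist (\<xi> n) (\<xi> (n + 1)) \<le> r" for n
      using \<xi>(1) by (auto simp: pseudo_orbit_def)
    have "\<xi> n = x" for n
    proof (induction n rule: int_induct[where k = 0])
      case base
      show ?case by fact
    next
      case (step1 i)
      then show ?case
        using isolated[OF \<xi>X] jump[of i] by simp
    next
      case (step2 i)
      then show ?case
        using isolated[OF \<xi>X] jump[of "i - 1"] by (simp add: dist_commute)
    qed
    then show ?thesis
      unfolding can_be_shadowed_def using assms(1) \<open>\<epsilon> > 0\<close>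
      by (intro bexI[of _ x]) (simp_all add: int_iterate_id)
  qed
  then show ?thesis
    using assms(1,2) unfolding Sh_def by blast
qed

text \<open>
  Distinct powers of \<open>1 / 2\<close> differ by a factor of at least 2, and the interval has no positive
  points, so the ball of radius \<open>(1 / 2)\<^sup>n / 4\<close> around \<open>(1 / 2)\<^sup>n\<close> contains no other point of the space.
\<close>

lemma half_power_shadowable:
  "(1 / 2) ^ n \<in> Sh interval_and_sequence dist id"
proof (rule isolated_shadowable_identity)
  define a where "a k = (1 / 2 :: real) ^ k" for k
  have pos: "a k > 0" for k
    by (simp add: a_def)
  have halving: "a l \<le> a k / 2" if "k < l" for k l
    using power_decreasing[of "Suc k" l "1 / 2 :: real"] that by (simp add: a_def)
  show "(1 / 2) ^ n \<in> interval_and_sequence"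
    by (simp add: interval_and_sequence_def)
  show "(1 / 2) ^ n / 4 > (0 :: real)"
    by simp
  fix y :: real
  assume y: "y \<in> interval_and_sequence" "dist ((1 / 2 :: real) ^ n) y \<le> (1 / 2) ^ n / 4"
  have near: "\<bar>a n - y\<bar> \<le> a n / 4"
    using y(2) by (simp only: dist_real_def a_def)
  then have "y > 0"
    using pos[of n] by linarith
  then obtain k where k: "y = a k"
    using y(1) by (auto simp: interval_and_sequence_def a_def)
  have "\<not> k < n"
    using halving[of k n] near pos[of n] pos[of k] unfolding k by linarith
  moreover have "\<not> n < k"
    using halving[of n k] near pos[of n] pos[of k] unfolding k by linarith
  ultimately show "y = (1 / 2) ^ n"
    unfolding k a_def by simp
qed

text \<open>
  Starting at 0, steps of any given size reach \<open>-1\<close> inside the interval, whereas the orbits of the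
  identity stay where they are, and no point is within \<open>1 / 3\<close> of both 0 and \<open>-1\<close>.
\<close>

lemma zero_not_shadowable: "0 \<notin> Sh interval_and_sequence dist id"
proof
  assume "0 \<in> Sh interval_and_sequence dist id"
  then obtain \<delta> where "\<delta> > 0" and \<delta>:
    "\<And>\<xi>. \<lbrakk>pseudo_orbit interval_and_sequence dist id \<delta> \<xi>; \<xi> 0 = 0\<rbrakk>
       \<Longrightarrow> can_be_shadowed interval_and_sequence dist id (1 / 3) \<xi>"
    unfolding Sh_def by (force dest: spec[of _ "1 / 3"])
  define \<xi> where "\<xi> n = max (- 1) (min 0 (- (real_of_int n * \<delta>)))" for n :: int
  have "\<xi> n \<in> interval_and_sequence" for n
    by (simp add: \<xi>_def interval_and_sequence_def)
  moreover have "dist (\<xi> n) (\<xi> (n + 1)) \<le> \<delta>" for n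
  proof -
    have "real_of_int (n + 1) * \<delta> = real_of_int n * \<delta> + \<delta>"
      by (simp add: algebra_simps)
    then show ?thesis
      unfolding \<xi>_def dist_real_def using \<open>\<delta> > 0\<close> by linarith
  qed
  ultimately have "pseudo_orbit interval_and_sequence dist id \<delta> \<xi>"
    by (simp add: pseudo_orbit_def)
  then obtain y where y: "y \<in> interval_and_sequence"
    "\<And>n. dist (int_iterate interval_and_sequence id n y) (\<xi> n) \<le> 1 / 3"
    using \<delta>[of \<xi>] by (auto simp: can_be_shadowed_def \<xi>_def)
  then have near: "dist y (\<xi> n) \<le> 1 / 3" for n
    using int_iterate_id by metis
  obtain N where "1 < real N * \<delta>"
    using reals_Archimedean3[OF \<open>\<delta> > 0\<close>] by blast
  then have "\<xi> (int N) = - 1" "\<xi> 0 = 0"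
    by (auto simp: \<xi>_def)
  then show False
    using near[of "int N"] near[of 0] by (simp add: dist_real_def abs_le_iff)
qed

lemma shadowable_set_not_compact:
  "\<not> compactin (Metric_space.mtopology interval_and_sequence dist)
       (Sh interval_and_sequence dist id)"
proof
  assume "compactin (Metric_space.mtopology interval_and_sequence dist)
    (Sh interval_and_sequence dist id)"
  then have "closed (Sh interval_and_sequence dist id)"
    by (simp add: mtopology_subset compactin_subtopology compact_imp_closed)
  then have "0 \<in> Sh interval_and_sequence dist id"
    by (rule closed_sequentially[where f = "\<lambda>n. (1 / 2) ^ n"])
      (simp_all add: half_power_shadowable LIMSEQ_power_zero)
  then show False
    using zero_not_shadowable by simp
qed

theorem theorem1p3:
  shows
    "(\<forall>(X :: 'a set) d f. compact_metric_homeo X d f \<longrightarrow> f ` Sh X d f = Sh X d f) \<and>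
     (\<exists>(X :: real set) d f. compact_metric_homeo X d f \<and>
        Sh X d f \<noteq> {} \<and> \<not> compactin (Metric_space.mtopology X d) (Sh X d f)) \<and>
     (\<forall>(X :: 'a set) d f. compact_metric_homeo X d f \<longrightarrow>
        (POTP X d f \<longleftrightarrow> Sh X d f = X)) \<and>
     (\<forall>(X :: 'a set) d f. compact_metric_homeo X d f \<longrightarrow>
        chain_recurrent_set X d f \<subseteq> Sh X d f \<longrightarrow>
        chain_recurrent_set X d f = nonwandering_set X d f)"
proof (intro conjI)
  show "\<forall>(X :: 'a set) d f. compact_metric_homeo X d f \<longrightarrow> f ` Sh X d f = Sh X d f"
    by (simp add: compact_metric_homeo_iff_locale compact_homeo.shadowable_set_invariant)
  show "\<exists>(X :: real set) d f. compact_metric_homeo X d f \<and>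
      Sh X d f \<noteq> {} \<and> \<not> compactin (Metric_space.mtopology X d) (Sh X d f)"
  proof (intro exI conjI)
    show "compact_metric_homeo interval_and_sequence dist id"
      by (rule identity_compact_metric_homeo[OF compact_interval_and_sequence])
    show "Sh interval_and_sequence dist id \<noteq> {}"
      using half_power_shadowable by blast
  qed (rule shadowable_set_not_compact)
  show "\<forall>(X :: 'a set) d f. compact_metric_homeo X d f \<longrightarrow> (POTP X d f \<longleftrightarrow> Sh X d f = X)"
    by (simp add: compact_metric_homeo_iff_locale compact_homeo.POTP_iff_all_shadowable)
  show "\<forall>(X :: 'a set) d f. compact_metric_homeo X d f \<longrightarrow>
      chain_recurrent_set X d f \<subseteq> Sh X d f \<longrightarrow>
      chain_recurrent_set X d f = nonwandering_set X d f"
    unfolding compact_metric_homeo_iff_locale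
    by (intro allI impI compact_homeo.chain_recurrent_eq_nonwandering)
qed

end
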